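(* Let $f$ be a non-constant entire function of order $\rho<1$. Then for every $z\in\mathbb{C}$, the convergence exponent of the sequence $\{\phi_{0n}(z)\}_n$ equals $\rho$. In addition, if $\rho\ne 0$, then $f$ is of maximal, minimal, or normal type according as the upper density $$\triangle(\{\phi_{0n}(z)\}_n)=\limsup_{r\to\infty}\frac{n_{\{\phi_{0n}(z)\}_n}(r)}{r^{\rho}}$$ of the orbit of any $z\in\mathbb{C}$ equals infinity, zero, or a number different from zero and infinity. In particular, this upper density is independent of $z$.
   Context: ${\rm Aut}(f)=\{\phi_{0n}\}_n$ denotes the automorphic functions of $f$ (branches of $f^{-1}\circ f$); for fixed $z$, the orbit $\{\phi_{0n}(z)\}_n$ is the set of zeros of $w\mapsto f(w)-f(z)$ listed with multiplicity, and $n_{\{\phi_{0n}(z)\}_n}(r)=|\{n:|\phi_{0n}(z)|<r\}|$. Convergence exponent of $\{a_n\}$: $\inf\{\lambda>0:\sum_{a_n\ne0}|a_n|^{-\lambda}<\infty\}$. With $M_f(r)=\max_{|w|=r}|f(w)|$ and type $\sigma=\limsup_{r\to\infty}\log M_f(r)/r^\rho$, $f$ is of maximal type if $\sigma=\infty$, minimal type if $\sigma=0$, normal type if $0<\sigma<\infty$.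
   Formalization: The closing claim that the upper density is independent of z is proved only for its class (infinite, zero, or finite positive); its numerical value can depend on z, e.g. for 1/2<ρ<1 and a product with regularly spaced negative zeros, where orbits of zeros have smaller density. *)

theory Defs
  imports "HOL-Complex_Analysis.Complex_Analysis"
begin

definition max_mod :: "(complex \<Rightarrow> complex) \<Rightarrow> real \<Rightarrow> real" where
  "max_mod f r = Sup ((\<lambda>w. norm (f w)) ` sphere 0 r)"

definition entire_order :: "(complex \<Rightarrow> complex) \<Rightarrow> ereal" where
  "entire_order f = Limsup at_top (\<lambda>r. ereal (ln (ln (max_mod f r)) / ln r))"

definition entire_type :: "(complex \<Rightarrow> complex) \<Rightarrow> real \<Rightarrow> ereal" where
  "entire_type f \<rho> = Limsup at_top (\<lambda>r. ereal (ln (max_mod f r) / r powr \<rho>))"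

text \<open>The orbit of z under the automorphic functions of f: the zeros of
  w \<mapsto> f w - f z, counted with multiplicity (mult. 0 off the orbit).\<close>
definition orbit_set :: "(complex \<Rightarrow> complex) \<Rightarrow> complex \<Rightarrow> complex set" where
  "orbit_set f z = {w. f w = f z}"

definition orbit_mult :: "(complex \<Rightarrow> complex) \<Rightarrow> complex \<Rightarrow> complex \<Rightarrow> nat" where
  "orbit_mult f z w = (if f w = f z then nat (zorder (\<lambda>u. f u - f z) w) else 0)"

definition orbit_count :: "(complex \<Rightarrow> complex) \<Rightarrow> complex \<Rightarrow> real \<Rightarrow> nat" where
  "orbit_count f z r = (\<Sum>w\<in>orbit_set f z \<inter> ball 0 r. orbit_mult f z w)"

definition orbit_conv_exp :: "(complex \<Rightarrow> complex) \<Rightarrow> complex \<Rightarrow> ereal" where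
  "orbit_conv_exp f z = Inf (ereal ` {s::real. s > 0 \<and>
      (\<lambda>w. real (orbit_mult f z w) * norm w powr (-s)) summable_on (orbit_set f z - {0})})"

definition orbit_upper_density :: "(complex \<Rightarrow> complex) \<Rightarrow> complex \<Rightarrow> real \<Rightarrow> ereal" where
  "orbit_upper_density f z \<rho> = Limsup at_top (\<lambda>r. ereal (real (orbit_count f z r) / r powr \<rho>))"

end

theory Submission
  imports Defs "HOL-Real_Asymp.Real_Asymp"
begin

text \<open>Write \<open>f w - f z = w ^ k * G w\<close> with \<open>G 0 \<noteq> 0\<close>; the zeros of \<open>G\<close> are the nonzero orbit points.
  Dividing \<open>G\<close> by the factors \<open>1 - w / a\<close> of its zeros \<open>a\<close> with \<open>norm a < r\<close> and applying the maximum
  principle on the circle of radius \<open>4r\<close> bounds the counting function of the orbit at \<open>r\<close> by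
  \<open>2 * ln (max_mod f (4 * r))\<close>, for large \<open>r\<close>. Conversely, the quotient of \<open>G\<close> by the factors
  with \<open>norm a < R\<close> has a logarithm on the disc of radius \<open>R\<close>, which by Borel-Caratheodory and order less
  than 1 tends to a constant as \<open>R\<close> grows. This gives
  \<open>ln (max_mod f r) \<le> (\<Sum>a. ln (1 + r / norm a)) + O(ln r)\<close> without the Hadamard factorisation. The two
  estimates, together with a dyadic summation over the moduli of the orbit points, compare the order
  with the convergence exponent and the type with the upper density.\<close>

section \<open>Division by zeros of entire functions\<close>

text \<open>\<open>zor_poly F a\<close> is controlled only near \<open>a\<close>, whereas
  \<open>F w / (w - a) ^ n\<close> is holomorphic away from \<open>a\<close>. The two agree on the
  overlap, so they glue to an entire quotient. The point \<open>w0\<close> excludes the zero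
  function.\<close>

lemma entire_divide_zero:
  fixes F :: "complex \<Rightarrow> complex"
  assumes "F holomorphic_on UNIV" and "F w0 \<noteq> 0"
  obtains H where "H holomorphic_on UNIV" "H a \<noteq> 0"
    "\<And>w. F w = H w * (w - a) ^ nat (zorder F a)"
proof -
  define n where "n = nat (zorder F a)"
  obtain r where r: "r > 0" "zor_poly F a holomorphic_on cball a r"
      "\<And>w. w \<in> cball a r \<Longrightarrow> F w = zor_poly F a w * (w - a) ^ n"
      "\<And>w. w \<in> cball a r \<Longrightarrow> zor_poly F a w \<noteq> 0"
    using zorder_exist_zero[OF assms(1) open_UNIV connected_UNIV UNIV_I, of a] assms(2)
    unfolding n_def by blast
  define H where "H = (\<lambda>w. if w = a then zor_poly F a a else F w / (w - a) ^ n)"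
  have "H holomorphic_on ball a r"
  proof (rule holomorphic_transform)
    show "zor_poly F a holomorphic_on ball a r"
      using r(2) ball_subset_cball holomorphic_on_subset by blast
    show "zor_poly F a w = H w" if "w \<in> ball a r" for w
      using r(3)[of w] that by (auto simp: H_def)
  qed
  moreover have "H holomorphic_on -{a}"
  proof (rule holomorphic_transform)
    show "(\<lambda>w. F w / (w - a) ^ n) holomorphic_on -{a}"
      by (intro holomorphic_intros holomorphic_on_subset[OF assms(1)]) auto
  qed (auto simp: H_def)
  ultimately have "H holomorphic_on ball a r \<union> -{a}"
    by (intro holomorphic_on_Un) auto
  also have "ball a r \<union> -{a} = UNIV"
    using r(1) by auto
  finally have "H holomorphic_on UNIV" .
  moreover have "H a \<noteq> 0"
    using r by (simp add: H_def)
  moreover have "F w = H w * (w - a) ^ n" for w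
    using r(1) r(3)[of a] by (cases "w = a") (simp_all add: H_def)
  ultimately show ?thesis
    using that unfolding n_def by blast
qed

lemma zorder_entire_eqI:
  fixes H :: "complex \<Rightarrow> complex"
  assumes "H holomorphic_on UNIV" "H a \<noteq> 0" "\<And>w. F w = H w * (w - a) ^ n"
  shows "zorder F a = int n"
  by (rule zorder_eqI[where S = UNIV and g = H]) (use assms in auto)

lemma entire_divide_zeros:
  fixes F :: "complex \<Rightarrow> complex"
  assumes "F holomorphic_on UNIV" and "F w0 \<noteq> 0" and "finite A"
  shows "\<exists>H. H holomorphic_on UNIV \<and> (\<forall>a\<in>A. H a \<noteq> 0) \<and>
    (\<forall>w. F w = H w * (\<Prod>a\<in>A. (w - a) ^ nat (zorder F a)))"
  using assms(3)
proof (induction A rule: finite_induct)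
  case empty
  then show ?case using assms(1) by auto
next
  case (insert b A)
  then obtain H where H: "H holomorphic_on UNIV" "\<forall>a\<in>A. H a \<noteq> 0"
    "\<And>w. F w = H w * (\<Prod>a\<in>A. (w - a) ^ nat (zorder F a))" by blast
  have "H w0 \<noteq> 0"
    using H(3)[of w0] assms(2) by auto
  from entire_divide_zero[OF H(1) this, of b] obtain K where K: "K holomorphic_on UNIV" "K b \<noteq> 0"
    "\<And>w. H w = K w * (w - b) ^ nat (zorder H b)" by blast
  define P where "P = (\<lambda>w. \<Prod>a\<in>A. (w - a) ^ nat (zorder F a))"
  \<comment> \<open>The factors at the points of \<open>A\<close> do not vanish at \<open>b\<close>,
    so removing them leaves the order at \<open>b\<close> unchanged. The multiplicities of
    \<open>F\<close> itself can therefore be used throughout the induction.\<close>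
  have "zorder F b = int (nat (zorder H b))"
  proof (rule zorder_entire_eqI)
    show "(\<lambda>w. K w * P w) holomorphic_on UNIV"
      unfolding P_def by (intro holomorphic_intros K)
    show "K b * P b \<noteq> 0"
      using K(2) insert.hyps by (auto simp: P_def)
    show "F w = K w * P w * (w - b) ^ nat (zorder H b)" for w
      using H(3)[of w] K(3)[of w] by (simp add: P_def)
  qed
  then have "nat (zorder H b) = nat (zorder F b)"
    by simp
  with K(3) have K3: "H w = K w * (w - b) ^ nat (zorder F b)" for w
    by simp
  have "K a \<noteq> 0" if "a \<in> A" for a
    using H(2) K3[of a] that by auto
  then have "\<forall>a\<in>insert b A. K a \<noteq> 0"
    using K(2) by blast
  moreover have "F w = K w * (\<Prod>a\<in>insert b A. (w - a) ^ nat (zorder F a))" for w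
    using H(3)[of w] K3[of w] insert.hyps by (simp add: mult_ac)
  ultimately show ?case
    using K(1) by (intro exI[of _ K] conjI allI)
qed

text \<open>Factors in the form \<open>1 - w / a\<close> equal 1 at the origin, so the quotient
  keeps the value \<open>G 0\<close>. The constant \<open>c\<close>, the product of the values of
  the factors \<open>w - a\<close> at 0, is absorbed into the quotient.\<close>

lemma entire_divide_nonzero_zeros:
  fixes G :: "complex \<Rightarrow> complex"
  assumes "G holomorphic_on UNIV" and "G 0 \<noteq> 0" and "finite A" and "0 \<notin> A"
  obtains H where "H holomorphic_on UNIV" "\<And>a. a \<in> A \<Longrightarrow> H a \<noteq> 0" "H 0 = G 0"
    "\<And>w. G w = H w * (\<Prod>a\<in>A. (1 - w / a) ^ nat (zorder G a))"
proof -
  obtain H where H: "H holomorphic_on UNIV" "\<forall>a\<in>A. H a \<noteq> 0"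
    "\<And>w. G w = H w * (\<Prod>a\<in>A. (w - a) ^ nat (zorder G a))"
    using entire_divide_zeros[OF assms(1-3)] by blast
  define c where "c = (\<Prod>a\<in>A. (-a) ^ nat (zorder G a))"
  have "c \<noteq> 0"
    using assms(3,4) by (auto simp: c_def)
  have "(\<Prod>a\<in>A. (w - a) ^ nat (zorder G a)) = c * (\<Prod>a\<in>A. (1 - w / a) ^ nat (zorder G a))" for w
    unfolding c_def prod.distrib[symmetric] power_mult_distrib[symmetric]
    using assms(4) by (intro prod.cong refl) (auto simp: field_simps)
  then have eq: "G w = (c * H w) * (\<Prod>a\<in>A. (1 - w / a) ^ nat (zorder G a))" for w
    using H(3)[of w] by simp
  show ?thesis
  proof (rule that[of "\<lambda>w. c * H w"])
    show "(\<lambda>w. c * H w) holomorphic_on UNIV"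
      by (intro holomorphic_intros H)
    show "c * H 0 = G 0"
      using eq[of 0] by simp
  qed (use H(2) \<open>c \<noteq> 0\<close> eq in auto)
qed

section \<open>Maximum principle, zero counting and growth bounds from the zeros\<close>

lemma norm_le_on_cball_of_sphere:
  fixes H :: "complex \<Rightarrow> complex"
  assumes "H holomorphic_on UNIV" "\<And>w. norm w = R \<Longrightarrow> norm (H w) \<le> M" "norm z \<le> R"
  shows "norm (H z) \<le> M"
proof (rule maximum_modulus_frontier[of H "cball 0 R"])
  show "H holomorphic_on interior (cball 0 R)" "continuous_on (closure (cball 0 R)) H"
    using assms(1) holomorphic_on_subset holomorphic_on_imp_continuous_on by blast+
qed (use assms in auto)

lemma entire_finite_zeros:
  fixes F :: "complex \<Rightarrow> complex"
  assumes "F holomorphic_on UNIV" and "F w0 \<noteq> 0"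
  shows "finite ({w. F w = 0} \<inter> ball 0 r)"
proof (cases "F constant_on UNIV")
  case True
  then show ?thesis
    using assms(2) by (auto simp: constant_on_def)
next
  case False
  have "finite {w \<in> cball 0 r. F w = 0}"
    by (rule holomorphic_compact_finite_zeros[OF assms(1)]) (use False in auto)
  then show ?thesis
    by (rule rev_finite_subset) auto
qed

text \<open>A substitute for Jensen's formula: on the circle of radius \<open>4r\<close> every factor
  \<open>1 - w / a\<close> with \<open>norm a < r\<close> has modulus at least 3.\<close>
lemma zero_count_le:
  fixes G :: "complex \<Rightarrow> complex"
  assumes G: "G holomorphic_on UNIV" "G 0 \<noteq> 0"
    and r: "r > 0" and M: "\<And>w. norm w = 4 * r \<Longrightarrow> norm (G w) \<le> M"
  shows "norm (G 0) * 3 ^ (\<Sum>a\<in>{w. G w = 0} \<inter> ball 0 r. nat (zorder G a)) \<le> M"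
proof -
  define A where "A = {w. G w = 0} \<inter> ball 0 r"
  have fin: "finite A" and "0 \<notin> A"
    using entire_finite_zeros[OF G] G by (auto simp: A_def)
  from entire_divide_nonzero_zeros[OF G this] obtain H where
    H: "H holomorphic_on UNIV" "H 0 = G 0"
      "\<And>w. G w = H w * (\<Prod>a\<in>A. (1 - w / a) ^ nat (zorder G a))" by metis
  define n where "n = (\<Sum>a\<in>A. nat (zorder G a))"
  \<comment> \<open>The quotient is at most \<open>M / 3 ^ n\<close> on the circle of radius
    \<open>4 * r\<close>, hence also at the centre, where it equals \<open>G 0\<close>.\<close>
  have "norm (H 0) \<le> M / 3 ^ n"
  proof (rule norm_le_on_cball_of_sphere[OF H(1)])
    fix w :: complex assume w: "norm w = 4 * r"
    have "3 ^ n = (\<Prod>a\<in>A. 3 ^ nat (zorder G a) :: real)"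
      by (simp add: n_def power_sum)
    also have "\<dots> \<le> (\<Prod>a\<in>A. norm (1 - w / a) ^ nat (zorder G a))"
    proof (intro prod_mono conjI power_mono)
      fix a assume "a \<in> A"
      then have a: "norm a < r" "a \<noteq> 0"
        using \<open>0 \<notin> A\<close> by (auto simp: A_def)
      have "4 \<le> norm (w / a)"
        using a r w by (simp add: norm_divide field_simps)
      also have "\<dots> \<le> norm (1 - w / a) + 1"
        by (metis add.commute norm_minus_commute norm_one norm_triangle_sub)
      finally show "3 \<le> norm (1 - w / a)" by simp
    qed auto
    also have "\<dots> = norm (\<Prod>a\<in>A. (1 - w / a) ^ nat (zorder G a))"
      by (simp add: prod_norm[symmetric] norm_power)
    finally have "norm (H w) * 3 ^ n \<le> norm (G w)"
      unfolding H(3)[of w] norm_mult by (intro mult_left_mono) auto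
    with M[OF w] show "norm (H w) \<le> M / 3 ^ n"
      by (simp add: field_simps)
  qed (use r in auto)
  then show ?thesis
    unfolding H(2) by (simp add: field_simps n_def A_def)
qed

text \<open>The map sending \<open>l\<close> to \<open>l / (2 * A - l)\<close> takes the half-plane
  \<open>Re l < A\<close> into the unit disc and fixes 0. The Schwarz lemma, applied after rescaling
  the disc of radius \<open>R\<close>, bounds the image of \<open>L w\<close>, and the inequality is
  then solved for \<open>norm (L w)\<close>.\<close>

lemma Borel_Caratheodory_0:
  fixes L :: "complex \<Rightarrow> complex"
  assumes L: "L holomorphic_on ball 0 R" "L 0 = 0"
    and A: "\<And>w. norm w < R \<Longrightarrow> Re (L w) < A" and "A > 0" and w: "norm w < R"
  shows "norm (L w) \<le> 2 * A * norm w / (R - norm w)"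
proof -
  have R: "R > 0"
    using w norm_ge_zero order_le_less_trans by blast
  define S where "S = (\<lambda>u. L (of_real R * u) / (2 * of_real A - L (of_real R * u)))"
  have in_ball: "norm (of_real R * u) < R" if "norm u < 1" for u :: complex
    using R that by (simp add: norm_mult)
  have nz: "2 * of_real A - L (of_real R * u) \<noteq> 0" if "norm u < 1" for u :: complex
  proof
    assume "2 * of_real A - L (of_real R * u) = 0"
    then have "Re (L (of_real R * u)) = 2 * A"
      by (metis Re_complex_of_real eq_iff_diff_eq_0 of_real_mult of_real_numeral)
    with A[OF in_ball[OF that]] \<open>A > 0\<close> show False by simp
  qed
  have "(L \<circ> (\<lambda>u. of_real R * u)) holomorphic_on ball 0 1"
    by (rule holomorphic_on_compose_gen[OF _ L(1)]) (use in_ball in \<open>auto intro!: holomorphic_intros\<close>)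
  then have "S holomorphic_on ball 0 1"
    unfolding S_def o_def using nz by (intro holomorphic_intros) auto
  moreover have "S 0 = 0"
    by (simp add: S_def L)
  moreover have "norm (S u) < 1" if u: "norm u < 1" for u
  proof -
    define l where "l = L (of_real R * u)"
    have "Re l < A"
      using A[OF in_ball[OF u]] by (simp add: l_def)
    \<comment> \<open>A point with real part below \<open>A\<close> is closer to 0 than to its
      mirror point \<open>2 * A\<close>; the identity makes this quantitative.\<close>
    have "(norm (2 * of_real A - l))\<^sup>2 - (norm l)\<^sup>2 = 4 * A * (A - Re l)"
      unfolding cmod_power2 by (simp add: power2_diff) (simp add: algebra_simps power2_eq_square)
    also have "\<dots> > 0"
      using \<open>Re l < A\<close> \<open>A > 0\<close> by simp
    finally have "norm l < norm (2 * of_real A - l)"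
      by (simp add: power2_less_imp_less)
    then show ?thesis
      unfolding S_def l_def[symmetric] norm_divide
      by (subst divide_less_eq_1_pos) (use norm_ge_zero[of l] in linarith)+
  qed
  ultimately have "norm (S (w / of_real R)) \<le> norm (w / of_real R)"
    using R w by (intro Schwarz_Lemma(1)) (auto simp: norm_divide)
  then have S: "norm (L w / (2 * of_real A - L w)) * R \<le> norm w"
    using R by (simp add: S_def norm_divide field_simps)
  have "2 * of_real A - L w \<noteq> 0"
    using nz[of "w / of_real R"] R w by (simp add: norm_divide)
  then have "norm (L w) * R \<le> norm w * norm (2 * of_real A - L w)"
    using S R by (simp add: norm_divide field_simps)
  also have "\<dots> \<le> norm w * (2 * A + norm (L w))"
    using norm_triangle_ineq4[of "2 * of_real A" "L w"] \<open>A > 0\<close>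
    by (intro mult_left_mono) (auto simp: norm_mult)
  finally show ?thesis
    using w by (simp add: field_simps)
qed

text \<open>On the circle of radius \<open>2R\<close> every factor \<open>1 - w / a\<close> with \<open>norm a < R\<close> has modulus
  at least 1, so that the quotient of \<open>G\<close> by these factors is still bounded by \<open>M\<close>; it has no zeros
  in the disc of radius \<open>R\<close>, and Borel-Caratheodory applies to its logarithm.\<close>
lemma norm_le_prod_zeros:
  fixes G :: "complex \<Rightarrow> complex"
  assumes G: "G holomorphic_on UNIV" "G 0 \<noteq> 0"
    and w: "norm w < R" and M: "\<And>w. norm w = 2 * R \<Longrightarrow> norm (G w) \<le> M"
  shows "norm (G w) \<le> norm (G 0) *
    exp ((\<Sum>a\<in>{w. G w = 0} \<inter> ball 0 R. real (nat (zorder G a)) * ln (1 + norm w / norm a))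
       + 2 * (ln (M / norm (G 0)) + 1) * norm w / (R - norm w))"
proof -
  have R: "R > 0"
    using w norm_ge_zero order_le_less_trans by blast
  define A where "A = {w. G w = 0} \<inter> ball 0 R"
  have fin: "finite A" and "0 \<notin> A"
    using entire_finite_zeros[OF G] G by (auto simp: A_def)
  from entire_divide_nonzero_zeros[OF G this] obtain H where
    H: "H holomorphic_on UNIV" "\<And>a. a \<in> A \<Longrightarrow> H a \<noteq> 0" "H 0 = G 0"
      "\<And>w. G w = H w * (\<Prod>a\<in>A. (1 - w / a) ^ nat (zorder G a))" by metis
  have HM: "norm (H u) \<le> M" if u: "norm u \<le> 2 * R" for u
  proof (rule norm_le_on_cball_of_sphere[OF H(1) _ u])
    fix v :: complex assume v: "norm v = 2 * R"
    have "1 \<le> (\<Prod>a\<in>A. norm (1 - v / a) ^ nat (zorder G a))"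
    proof (intro prod_ge_1 one_le_power)
      fix a assume "a \<in> A"
      then have a: "norm a < R" "a \<noteq> 0"
        using \<open>0 \<notin> A\<close> by (auto simp: A_def)
      have "2 \<le> norm (v / a)"
        using a R v by (simp add: norm_divide field_simps)
      also have "\<dots> \<le> norm (1 - v / a) + 1"
        by (metis add.commute norm_minus_commute norm_one norm_triangle_sub)
      finally show "1 \<le> norm (1 - v / a)" by simp
    qed
    also have "\<dots> = norm (\<Prod>a\<in>A. (1 - v / a) ^ nat (zorder G a))"
      by (simp add: prod_norm[symmetric] norm_power)
    finally have "norm (H v) * 1 \<le> norm (G v)"
      unfolding H(4)[of v] norm_mult by (intro mult_left_mono) auto
    with M[OF v] show "norm (H v) \<le> M" by simp
  qed
  have Hnz: "H u \<noteq> 0" if "u \<in> ball 0 R" for u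
    using H(2)[of u] H(4)[of u] that by (cases "G u = 0") (auto simp: A_def)
  obtain l where l: "l holomorphic_on ball 0 R" "\<And>u. u \<in> ball 0 R \<Longrightarrow> exp (l u) = H u"
    using holomorphic_logarithm_exists[of "ball 0 R" H 0] Hnz R H(1) holomorphic_on_subset
    by (metis centre_in_ball convex_ball open_ball subset_UNIV)
  \<comment> \<open>Subtracting \<open>l 0\<close> normalises the logarithm to vanish at 0, as
    Borel-Caratheodory demands; correspondingly \<open>exp (L u)\<close> is
    \<open>H u / G 0\<close>.\<close>
  define L where "L = (\<lambda>u. l u - l 0)"
  have eL: "exp (L u) = H u / G 0" if "u \<in> ball 0 R" for u
    using l(2)[OF that] l(2)[of 0] R by (simp add: L_def exp_diff H(3))
  have G0: "norm (G 0) > 0"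
    using G by simp
  have "norm (G 0) \<le> M"
    using HM[of 0] R by (simp add: H(3))
  then have lnM: "ln (M / norm (G 0)) \<ge> 0"
    using G0 by (intro ln_ge_zero) (simp add: field_simps)
  \<comment> \<open>The summand 1 provides the strict bound on the real part and the positive
    constant, even when \<open>ln (M / norm (G 0))\<close> is 0.\<close>
  have "norm (L w) \<le> 2 * (ln (M / norm (G 0)) + 1) * norm w / (R - norm w)"
  proof (rule Borel_Caratheodory_0)
    show "L holomorphic_on ball 0 R"
      unfolding L_def by (intro holomorphic_intros l)
    fix u :: complex assume u: "norm u < R"
    then have "exp (Re (L u)) = norm (H u) / norm (G 0)"
      by (simp add: eL norm_divide flip: norm_exp_eq_Re)
    also have "\<dots> \<le> M / norm (G 0)"
      using HM[of u] u R by (intro divide_right_mono) auto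
    finally have "Re (L u) \<le> ln (M / norm (G 0))"
      using ln_mono[of "exp (Re (L u))"] by simp
    then show "Re (L u) < ln (M / norm (G 0)) + 1" by simp
  qed (use lnM w in \<open>auto simp: L_def\<close>)
  then have "norm (exp (L w)) \<le> exp (2 * (ln (M / norm (G 0)) + 1) * norm w / (R - norm w))"
    by (meson exp_le_cancel_iff norm_exp order_trans)
  then have H_le: "norm (H w) \<le> norm (G 0) * exp (2 * (ln (M / norm (G 0)) + 1) * norm w / (R - norm w))"
    using eL[of w] w G0 by (simp add: norm_divide field_simps)
  have "norm (\<Prod>a\<in>A. (1 - w / a) ^ nat (zorder G a)) = (\<Prod>a\<in>A. norm (1 - w / a) ^ nat (zorder G a))"
    by (simp add: prod_norm[symmetric] norm_power)
  also have "\<dots> \<le> (\<Prod>a\<in>A. exp (real (nat (zorder G a)) * ln (1 + norm w / norm a)))"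
  proof (intro prod_mono conjI)
    fix a assume "a \<in> A"
    have pos: "1 + norm w / norm a > 0"
      by (simp add: add_pos_nonneg)
    have "norm (1 - w / a) \<le> 1 + norm w / norm a"
      by (metis norm_divide norm_one norm_triangle_ineq4)
    then have "norm (1 - w / a) ^ nat (zorder G a) \<le> (1 + norm w / norm a) ^ nat (zorder G a)"
      by (intro power_mono) auto
    also have "\<dots> = exp (real (nat (zorder G a)) * ln (1 + norm w / norm a))"
      using pos by (simp add: exp_of_nat_mult)
    finally show "norm (1 - w / a) ^ nat (zorder G a) \<le> exp (real (nat (zorder G a)) * ln (1 + norm w / norm a))" .
  qed auto
  also have "\<dots> = exp (\<Sum>a\<in>A. real (nat (zorder G a)) * ln (1 + norm w / norm a))"
    using fin by (simp add: exp_sum)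
  finally have "norm (G w) \<le> (norm (G 0) * exp (2 * (ln (M / norm (G 0)) + 1) * norm w / (R - norm w)))
      * exp (\<Sum>a\<in>A. real (nat (zorder G a)) * ln (1 + norm w / norm a))"
    unfolding H(4)[of w] norm_mult using H_le by (intro mult_mono) auto
  then show ?thesis
    by (simp add: exp_add mult_ac A_def)
qed

text \<open>Only sublinear growth of \<open>ln (M R)\<close> is needed to make the exponential factor of the Hadamard
  factorisation disappear in the limit; this is where order less than 1 enters.\<close>
lemma norm_le_exp_zero_sum:
  fixes G :: "complex \<Rightarrow> complex"
  assumes G: "G holomorphic_on UNIV" "G 0 \<noteq> 0"
    and M: "\<forall>\<^sub>F R in at_top. \<forall>w. norm w = R \<longrightarrow> norm (G w) \<le> M R"
    and sublinear: "((\<lambda>R. ln (M R) / R) \<longlongrightarrow> 0) at_top"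
    and B: "\<And>R. (\<Sum>a\<in>{w. G w = 0} \<inter> ball 0 R. real (nat (zorder G a)) * ln (1 + norm w / norm a)) \<le> B"
  shows "norm (G w) \<le> norm (G 0) * exp B"
proof (rule tendsto_lowerbound)
  have M2: "\<forall>\<^sub>F R in at_top. \<forall>w. norm w = 2 * R \<longrightarrow> norm (G w) \<le> M (2 * R)"
    using M filterlim_tendsto_pos_mult_at_top[OF tendsto_const _ filterlim_ident, of 2]
    unfolding filterlim_iff by auto
  \<comment> \<open>\<open>T R\<close> is the Borel-Caratheodory error at radius \<open>R\<close>,
    rearranged so that the vanishing quotient \<open>ln (M (2 * R)) / (2 * R)\<close> is multiplied
    by a factor that stays bounded.\<close>
  define T where "T = (\<lambda>R. 4 * norm w * (ln (M (2 * R)) / (2 * R)) * (R / (R - norm w))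
      + 2 * norm w * (1 - ln (norm (G 0))) / (R - norm w))"
  have "((\<lambda>R. ln (M (2 * R)) / (2 * R)) \<longlongrightarrow> 0) at_top"
    using filterlim_compose[OF sublinear, of "\<lambda>R. 2 * R"]
      filterlim_tendsto_pos_mult_at_top[OF tendsto_const _ filterlim_ident, of "2::real"] by simp
  moreover have "((\<lambda>R. R / (R - norm w)) \<longlongrightarrow> 1) at_top"
    by real_asymp
  moreover have "((\<lambda>R. 2 * norm w * (1 - ln (norm (G 0))) / (R - norm w)) \<longlongrightarrow> 0) at_top"
    by real_asymp
  ultimately have "(T \<longlongrightarrow> 4 * norm w * 0 * 1 + 0) at_top"
    unfolding T_def by (intro tendsto_intros)
  then show "((\<lambda>R. norm (G 0) * exp (B + T R)) \<longlongrightarrow> norm (G 0) * exp B) at_top"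
    by (auto intro!: tendsto_eq_intros)
  show "\<forall>\<^sub>F R in at_top. norm (G w) \<le> norm (G 0) * exp (B + T R)"
    using M2 eventually_gt_at_top[of "norm w"] eventually_gt_at_top[of 0]
  proof eventually_elim
    case (elim R)
    have "norm (G 0) \<le> M (2 * R)"
      by (rule norm_le_on_cball_of_sphere[OF G(1), of "2 * R"]) (use elim in auto)
    then have Mpos: "M (2 * R) > 0" "norm (G 0) > 0"
      using G(2) by (auto intro: less_le_trans[of 0 "norm (G 0)"])
    have "2 * (ln (M (2 * R) / norm (G 0)) + 1) * norm w / (R - norm w) = T R"
      using elim Mpos by (simp add: T_def ln_div divide_simps) (simp add: algebra_simps)
    then have "norm (G w) \<le> norm (G 0) *
      exp ((\<Sum>a\<in>{w. G w = 0} \<inter> ball 0 R. real (nat (zorder G a)) * ln (1 + norm w / norm a)) + T R)"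
      using norm_le_prod_zeros[OF G, of w R "M (2 * R)"] elim by auto
    also have "\<dots> \<le> norm (G 0) * exp (B + T R)"
      using B[of R] by (intro mult_left_mono) auto
    finally show ?case .
  qed
qed simp

section \<open>Dyadic summation\<close>

lemma two_power_powr: "(2 ^ n :: real) powr s = 2 powr (s * real n)"
proof -
  have "(2 ^ n :: real) powr s = (2 powr real n) powr s"
    by (subst powr_realpow) auto
  then show ?thesis
    by (simp only: powr_powr mult.commute)
qed

lemma two_powr_power: "(2 powr x) ^ n = (2::real) powr (x * real n)"
proof -
  have "(2 powr x) ^ n = ((2::real) powr x) powr real n"
    by (subst powr_realpow) auto
  then show ?thesis
    by (simp only: powr_powr)
qed

text \<open>This converts logarithmic sums into power sums with an exponent of choice. For
  \<open>x \<le> 1\<close> it follows from \<open>ln (1 + x) \<le> x \<le> x powr s\<close>. For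
  larger \<open>x\<close>, writing \<open>ln x\<close> as \<open>ln (x powr s) / s\<close> gains a
  term \<open>- 1 / s\<close>, which absorbs \<open>ln 2\<close>.\<close>

lemma ln_one_plus_le_powr:
  fixes x s :: real
  assumes "0 < s" "s \<le> 1" "0 \<le> x"
  shows "ln (1 + x) \<le> x powr s / s"
proof (cases "x \<le> 1")
  case True
  have "ln (1 + x) \<le> x"
    using assms by (simp add: ln_add_one_self_le_self)
  also have "\<dots> \<le> x powr s"
    using powr_mono'[of s 1 x] assms True by simp
  also have "\<dots> \<le> x powr s / s"
    using assms mult_left_le_one_le[of "x powr s" s] by (simp add: field_simps)
  finally show ?thesis .
next
  case False
  then have "ln (1 + x) \<le> ln (2 * x)"
    by (intro ln_mono) auto
  also have "\<dots> = ln 2 + ln x"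
    using False by (simp add: ln_mult)
  also have "ln (2::real) \<le> 1 / s"
  proof -
    have "1 \<le> 1 / s"
      using assms by simp
    then show ?thesis
      using ln_2_less_1 by linarith
  qed
  also have "ln x = ln (x powr s) / s"
    using False assms by (simp add: ln_powr)
  also have "\<dots> \<le> (x powr s - 1) / s"
    using False assms by (intro divide_right_mono ln_le_minus_one) auto
  finally show ?thesis
    using assms by (simp add: field_simps)
qed

text \<open>Each point of \<open>B\<close> is charged to some layer whose cost dominates its weight.
  The layers \<open>p a < t j\<close> are cumulative and overcount, which is harmless for
  nonnegative terms; exchanging the sums then leaves only values of the counting function.\<close>

lemma sum_le_sum_layers:
  fixes m g p :: "'a \<Rightarrow> real" and c t :: "'b \<Rightarrow> real"
  assumes "finite A" "finite J" "B \<subseteq> A" "\<And>a. m a \<ge> 0" "\<And>j. c j \<ge> 0"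
    and cover: "\<And>a. a \<in> B \<Longrightarrow> \<exists>j\<in>J. p a < t j \<and> g a \<le> c j"
  shows "(\<Sum>a\<in>B. m a * g a) \<le> (\<Sum>j\<in>J. c j * (\<Sum>a\<in>{a\<in>A. p a < t j}. m a))"
proof -
  have "(\<Sum>a\<in>B. m a * g a) \<le> (\<Sum>a\<in>B. m a * (\<Sum>j\<in>J. if p a < t j then c j else 0))"
  proof (intro sum_mono mult_left_mono)
    fix a assume "a \<in> B"
    from cover[OF this] obtain j where j: "j \<in> J" "p a < t j" "g a \<le> c j"
      by blast
    have "g a \<le> (if p a < t j then c j else 0)"
      using j by simp
    also have "\<dots> \<le> (\<Sum>j\<in>J. if p a < t j then c j else 0)"
      using j assms by (intro member_le_sum) auto
    finally show "g a \<le> (\<Sum>j\<in>J. if p a < t j then c j else 0)" .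
  qed (use assms in auto)
  also have "\<dots> \<le> (\<Sum>a\<in>A. m a * (\<Sum>j\<in>J. if p a < t j then c j else 0))"
    using assms by (intro sum_mono2) (auto intro!: mult_nonneg_nonneg sum_nonneg)
  also have "\<dots> = (\<Sum>j\<in>J. \<Sum>a\<in>A. m a * (if p a < t j then c j else 0))"
    by (simp add: sum_distrib_left sum.swap[of _ J A])
  also have "\<dots> = (\<Sum>j\<in>J. c j * (\<Sum>a\<in>{a\<in>A. p a < t j}. m a))"
    using assms(1) by (intro sum.cong refl)
      (simp add: sum_distrib_left sum.inter_filter if_distrib mult.commute cong: if_cong)
  finally show ?thesis .
qed

lemma sum_power_le_geometric:
  fixes q :: real
  assumes "0 \<le> q" "q < 1" "finite J"
  shows "(\<Sum>j\<in>J. q ^ j) \<le> 1 / (1 - q)"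
proof -
  have "(\<Sum>j\<in>J. q ^ j) \<le> suminf (\<lambda>j. q ^ j)"
    using assms by (intro sum_le_suminf summable_geometric) auto
  then show ?thesis
    using assms by (simp add: suminf_geometric)
qed

text \<open>On the shell \<open>2 ^ j * r \<le> p a < 2 ^ Suc j * r\<close> the weight is at most
  \<open>2 powr (- s * j)\<close> and the count at most \<open>D * (2 ^ Suc j * r) powr t\<close>.
  The products form a geometric series of ratio \<open>2 powr (t - s)\<close>, so the bound is
  uniform in \<open>A\<close>.\<close>

lemma sum_outer_layers_le:
  fixes m p :: "'a \<Rightarrow> real"
  assumes "finite A" "\<And>a. m a \<ge> 0" and r: "r > 0" and D: "D \<ge> 0" and s: "0 < s" "t < s"
    and count: "\<And>x. x \<ge> r \<Longrightarrow> (\<Sum>a\<in>{a\<in>A. p a < x}. m a) \<le> D * x powr t"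
  shows "(\<Sum>a\<in>{a\<in>A. r \<le> p a}. m a * (r / p a) powr s)
    \<le> 2 powr t / (1 - 2 powr (t - s)) * D * r powr t"
proof -
  \<comment> \<open>\<open>k a\<close> is the index of the dyadic shell containing \<open>a\<close>;
    minimality yields the lower bound on \<open>p a\<close>.\<close>
  define k where "k = (\<lambda>a. LEAST j. p a < 2 ^ Suc j * r)"
  define J where "J = k ` A"
  define q where "q = 2 powr (t - s)"
  have q: "0 \<le> q" "q < 1"
    using s by (auto simp: q_def powr_less_one)
  have "(\<Sum>a\<in>{a\<in>A. r \<le> p a}. m a * (r / p a) powr s)
    \<le> (\<Sum>j\<in>J. 2 powr (- s * real j) * (\<Sum>a\<in>{a\<in>A. p a < 2 ^ Suc j * r}. m a))"
  proof (rule sum_le_sum_layers)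
    fix a assume "a \<in> {a\<in>A. r \<le> p a}"
    then have a: "a \<in> A" "r \<le> p a" by auto
    obtain n where "p a / r < 2 ^ n"
      using real_arch_pow[of 2 "p a / r"] by auto
    also have "\<dots> \<le> 2 ^ Suc n" by simp
    finally have "p a < 2 ^ Suc n * r"
      using r by (simp add: field_simps)
    then have k1: "p a < 2 ^ Suc (k a) * r"
      unfolding k_def by (rule LeastI)
    have k2: "2 ^ k a * r \<le> p a"
    proof (cases "k a")
      case 0
      then show ?thesis using a by simp
    next
      case (Suc i)
      then have "\<not> p a < 2 ^ Suc i * r"
        using not_less_Least[of i "\<lambda>j. p a < 2 ^ Suc j * r"] by (simp add: k_def)
      then show ?thesis using Suc by simp
    qed
    have "(r / p a) powr s \<le> (inverse (2 ^ k a)) powr s"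
      using k2 a r s by (intro powr_mono2) (auto simp: field_simps)
    also have "\<dots> = 2 powr (- s * real (k a))"
      by (simp add: inverse_eq_divide powr_divide two_power_powr powr_minus)
    finally show "\<exists>j\<in>J. p a < 2 ^ Suc j * r \<and> (r / p a) powr s \<le> 2 powr (- s * real j)"
      using k1 a by (auto simp: J_def)
  qed (use assms in \<open>auto simp: J_def\<close>)
  also have "\<dots> \<le> (\<Sum>j\<in>J. 2 powr (- s * real j) * (D * (2 ^ Suc j * r) powr t))"
  proof (intro sum_mono mult_left_mono count)
    fix j
    have "1 * r \<le> 2 ^ Suc j * r"
      using r by (intro mult_right_mono one_le_power) auto
    then show "r \<le> 2 ^ Suc j * r" by simp
  qed auto
  also have "\<dots> = (\<Sum>j\<in>J. (2 powr t * D * r powr t) * q ^ j)"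
  proof (intro sum.cong refl)
    fix j
    have "(2 ^ Suc j * r) powr t = 2 powr t * 2 powr (t * real j) * r powr t"
      using r by (simp add: powr_mult two_power_powr)
    then have "2 powr (- s * real j) * (D * (2 ^ Suc j * r) powr t)
        = (2 powr t * D * r powr t) * (2 powr (- s * real j) * 2 powr (t * real j))"
      by simp
    also have "2 powr (- s * real j) * 2 powr (t * real j) = q ^ j"
      unfolding q_def two_powr_power powr_add[symmetric] by (simp add: algebra_simps)
    finally show "2 powr (- s * real j) * (D * (2 ^ Suc j * r) powr t)
        = (2 powr t * D * r powr t) * q ^ j" .
  qed
  also have "\<dots> = (2 powr t * D * r powr t) * (\<Sum>j\<in>J. q ^ j)"
    by (simp add: sum_distrib_left)
  also have "\<dots> \<le> (2 powr t * D * r powr t) * (1 / (1 - q))"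
    using q D assms(1) by (intro mult_left_mono sum_power_le_geometric) (auto simp: J_def)
  finally show ?thesis
    by (simp add: q_def mult_ac)
qed

text \<open>The mirror image of the outer estimate, with shells
  \<open>r / 2 ^ Suc j \<le> p a < r / 2 ^ j\<close>. Towards the centre the weights grow like
  \<open>2 powr (s * j)\<close> while the counts shrink like \<open>2 powr (- t * j)\<close>, so
  convergence now asks for \<open>s < t\<close>.\<close>

lemma sum_inner_layers_le:
  fixes m p :: "'a \<Rightarrow> real"
  assumes "finite A" "\<And>a. m a \<ge> 0" and r0: "r0 > 0" and D: "D \<ge> 0" and s: "0 < s" "s < t"
    and count: "\<And>x. x \<ge> r0 \<Longrightarrow> (\<Sum>a\<in>{a\<in>A. p a < x}. m a) \<le> D * x powr t"
  shows "(\<Sum>a\<in>{a\<in>A. r0 \<le> p a \<and> p a < r}. m a * (r / p a) powr s)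
    \<le> 2 powr s / (1 - 2 powr (s - t)) * D * r powr t"
proof (cases "r > 0")
  case False
  then have "{a\<in>A. r0 \<le> p a \<and> p a < r} = {}"
    using r0 by auto
  moreover have "2 powr (s - t) < 1"
    using s by (simp add: powr_less_one)
  ultimately show ?thesis
    using D by (simp only: sum.empty) auto
next
  case r: True
  define k where "k = (\<lambda>a. LEAST j. r / 2 ^ Suc j \<le> p a)"
  \<comment> \<open>Only shells with outer radius at least \<open>r0\<close> are kept, since the
    counting bound is available just there; every point with \<open>r0 \<le> p a\<close> lies in
    such a shell.\<close>
  define J where "J = {j \<in> k ` A. r0 \<le> r / 2 ^ j}"
  define q where "q = 2 powr (s - t)"
  have q: "0 \<le> q" "q < 1"
    using s by (auto simp: q_def powr_less_one)
  have "(\<Sum>a\<in>{a\<in>A. r0 \<le> p a \<and> p a < r}. m a * (r / p a) powr s)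
    \<le> (\<Sum>j\<in>J. 2 powr (s * real (Suc j)) * (\<Sum>a\<in>{a\<in>A. p a < r / 2 ^ j}. m a))"
  proof (rule sum_le_sum_layers)
    fix a assume "a \<in> {a\<in>A. r0 \<le> p a \<and> p a < r}"
    then have a: "a \<in> A" "r0 \<le> p a" "p a < r" "p a > 0"
      using r0 by auto
    obtain n where "r / p a < 2 ^ n"
      using real_arch_pow[of 2 "r / p a"] by auto
    also have "\<dots> \<le> 2 ^ Suc n" by simp
    finally have "r / 2 ^ Suc n \<le> p a"
      using a by (simp add: field_simps)
    then have k1: "r / 2 ^ Suc (k a) \<le> p a"
      unfolding k_def by (rule LeastI)
    have k2: "p a < r / 2 ^ k a"
    proof (cases "k a")
      case 0
      then show ?thesis using a by simp
    next
      case (Suc i)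
      then have "\<not> r / 2 ^ Suc i \<le> p a"
        using not_less_Least[of i "\<lambda>j. r / 2 ^ Suc j \<le> p a"] by (simp add: k_def)
      then show ?thesis using Suc by simp
    qed
    have "(r / p a) powr s \<le> (2 ^ Suc (k a)) powr s"
      using k1 a r s by (intro powr_mono2) (auto simp: field_simps)
    also have "\<dots> = 2 powr (s * real (Suc (k a)))"
      by (rule two_power_powr)
    finally have "p a < r / 2 ^ k a \<and> (r / p a) powr s \<le> 2 powr (s * real (Suc (k a)))"
      using k2 by simp
    moreover have "k a \<in> J"
      using k2 a by (auto simp: J_def)
    ultimately show "\<exists>j\<in>J. p a < r / 2 ^ j \<and> (r / p a) powr s \<le> 2 powr (s * real (Suc j))"
      by blast
  qed (use assms in \<open>auto simp: J_def\<close>)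
  also have "\<dots> \<le> (\<Sum>j\<in>J. 2 powr (s * real (Suc j)) * (D * (r / 2 ^ j) powr t))"
    by (intro sum_mono mult_left_mono count) (auto simp: J_def)
  also have "\<dots> = (\<Sum>j\<in>J. (2 powr s * D * r powr t) * q ^ j)"
  proof (intro sum.cong refl)
    fix j
    have "(r / 2 ^ j) powr t = r powr t * 2 powr (- t * real j)"
      using r by (simp add: powr_divide two_power_powr powr_minus_divide)
    then have "2 powr (s * real (Suc j)) * (D * (r / 2 ^ j) powr t)
        = (D * r powr t) * (2 powr (s * real (Suc j)) * 2 powr (- t * real j))"
      by simp
    also have "2 powr (s * real (Suc j)) * 2 powr (- t * real j) = 2 powr s * q ^ j"
      unfolding q_def two_powr_power powr_add[symmetric] by (simp add: algebra_simps)
    finally show "2 powr (s * real (Suc j)) * (D * (r / 2 ^ j) powr t)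
        = (2 powr s * D * r powr t) * q ^ j"
      by (simp only: mult_ac)
  qed
  also have "\<dots> = (2 powr s * D * r powr t) * (\<Sum>j\<in>J. q ^ j)"
    by (simp add: sum_distrib_left)
  also have "\<dots> \<le> (2 powr s * D * r powr t) * (1 / (1 - q))"
    using q D assms(1) by (intro mult_left_mono sum_power_le_geometric) (auto simp: J_def)
  finally show ?thesis
    by (simp add: q_def mult_ac)
qed

text \<open>The exponents \<open>t / 2 < t < (1 + t) / 2\<close> serve for the inner and the outer layers.\<close>
definition layer_const :: "real \<Rightarrow> real" where
  "layer_const t = 2 powr (t / 2) / (1 - 2 powr (t / 2 - t)) / (t / 2)
    + 2 powr t / (1 - 2 powr (t - (1 + t) / 2)) / ((1 + t) / 2)"

lemma layer_const_pos:
  assumes "0 < t" "t < 1"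
  shows "layer_const t > 0"
proof -
  have "2 powr (t / 2 - t) < 1" "2 powr (t - (1 + t) / 2) < 1"
    using assms by (auto intro!: powr_less_one)
  then show ?thesis
    unfolding layer_const_def using assms by (intro add_pos_pos divide_pos_pos) auto
qed

text \<open>The sum is split at \<open>r\<close>, and the logarithm is replaced by a power below
  \<open>t\<close> inside and above \<open>t\<close> outside. The bound on the logarithm requires
  exponents at most 1, and \<open>t < 1\<close> leaves room for the outer one. The resulting
  constant depends on \<open>t\<close> alone.\<close>

lemma ln_sum_le_layer_const:
  fixes m p :: "'a \<Rightarrow> real"
  assumes t: "0 < t" "t < 1"
    and A: "finite A" "\<And>a. m a \<ge> 0" "D \<ge> 0" "0 < r0" "r0 \<le> r"
    and count: "\<And>x. x \<ge> r0 \<Longrightarrow> (\<Sum>a\<in>{a\<in>A. p a < x}. m a) \<le> D * x powr t"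
  shows "(\<Sum>a\<in>{a\<in>A. r0 \<le> p a}. m a * ln (1 + r / p a)) \<le> layer_const t * D * r powr t"
proof -
  define u where "u = t / 2"
  define v where "v = (1 + t) / 2"
  have uv: "0 < u" "u < t" "t < v" "v < 1" "0 < v" "u < 1"
    using t by (auto simp: u_def v_def)
  define C1 where "C1 = 2 powr u / (1 - 2 powr (u - t))"
  define C2 where "C2 = 2 powr t / (1 - 2 powr (t - v))"
  have ln_le: "m a * ln (1 + r / p a) \<le> 1 / s * (m a * (r / p a) powr s)"
    if "r0 \<le> p a" "0 < s" "s < 1" for a s
  proof -
    have "m a * ln (1 + r / p a) \<le> m a * ((r / p a) powr s / s)"
      using that A by (intro mult_left_mono ln_one_plus_le_powr) auto
    then show ?thesis by simp
  qed
  have split: "{a\<in>A. r0 \<le> p a} = {a\<in>A. r0 \<le> p a \<and> p a < r} \<union> {a\<in>A. r \<le> p a}"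
    using A by auto
  have "(\<Sum>a\<in>{a\<in>A. r0 \<le> p a}. m a * ln (1 + r / p a))
      = (\<Sum>a\<in>{a\<in>A. r0 \<le> p a \<and> p a < r}. m a * ln (1 + r / p a))
      + (\<Sum>a\<in>{a\<in>A. r \<le> p a}. m a * ln (1 + r / p a))"
    unfolding split using A by (intro sum.union_disjoint) auto
  also have "(\<Sum>a\<in>{a\<in>A. r0 \<le> p a \<and> p a < r}. m a * ln (1 + r / p a))
      \<le> 1 / u * (\<Sum>a\<in>{a\<in>A. r0 \<le> p a \<and> p a < r}. m a * (r / p a) powr u)"
    unfolding sum_distrib_left using uv by (intro sum_mono ln_le) auto
  also have "\<dots> \<le> 1 / u * (C1 * D * r powr t)"
    unfolding C1_def using uv A count by (intro mult_left_mono sum_inner_layers_le) auto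
  also have "(\<Sum>a\<in>{a\<in>A. r \<le> p a}. m a * ln (1 + r / p a))
      \<le> 1 / v * (\<Sum>a\<in>{a\<in>A. r \<le> p a}. m a * (r / p a) powr v)"
    unfolding sum_distrib_left using uv A by (intro sum_mono ln_le) auto
  also have "\<dots> \<le> 1 / v * (C2 * D * r powr t)"
    unfolding C2_def using uv A count by (intro mult_left_mono sum_outer_layers_le) auto
  finally have "(\<Sum>a\<in>{a\<in>A. r0 \<le> p a}. m a * ln (1 + r / p a)) \<le> (C1 / u + C2 / v) * D * r powr t"
    by (simp add: algebra_simps)
  then show ?thesis
    by (simp add: layer_const_def C1_def C2_def u_def v_def)
qed

section \<open>The maximum modulus and orbits\<close>

text \<open>Compactness of the circle bounds the set in the definition of \<open>max_mod\<close>, so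
  its \<open>Sup\<close> is an upper bound there; the maximum principle carries it to the
  disc.\<close>

lemma norm_le_max_mod:
  assumes f: "f holomorphic_on UNIV" and "norm w \<le> r"
  shows "norm (f w) \<le> max_mod f r"
proof (rule norm_le_on_cball_of_sphere[OF f _ assms(2)])
  fix u :: complex assume "norm u = r"
  moreover have "compact ((\<lambda>w. norm (f w)) ` sphere 0 r)"
    using f by (intro compact_continuous_image continuous_on_norm)
      (auto intro: holomorphic_on_imp_continuous_on holomorphic_on_subset)
  then have "bdd_above ((\<lambda>w. norm (f w)) ` sphere 0 r)"
    by (intro bounded_imp_bdd_above compact_imp_bounded)
  ultimately show "norm (f u) \<le> max_mod f r"
    unfolding max_mod_def by (intro cSup_upper) auto
qed

lemma max_mod_le:
  assumes "r \<ge> 0" "\<And>w. norm w = r \<Longrightarrow> norm (f w) \<le> B"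
  shows "max_mod f r \<le> B"
proof -
  \<comment> \<open>The circle must be nonempty for \<open>Sup\<close> to be a least upper bound;
    this is where \<open>r \<ge> 0\<close> is used.\<close>
  have "of_real r \<in> sphere (0::complex) r"
    using assms(1) by simp
  then show ?thesis
    unfolding max_mod_def using assms(2) by (intro cSup_least) auto
qed

text \<open>Liouville's theorem gives unboundedness, and the bound on discs makes it persist for all
  larger radii. Hence the single and iterated logarithms of \<open>max_mod\<close> are eventually
  taken at positive arguments.\<close>

lemma filterlim_max_mod_at_top:
  assumes f: "f holomorphic_on UNIV" and nonconst: "\<not> (\<exists>c. \<forall>w. f w = c)"
  shows "filterlim (max_mod f) at_top at_top"
  unfolding filterlim_at_top
proof
  fix B :: real
  have "\<not> bounded (range f)"
    using Liouville_theorem[OF f] nonconst by (auto simp: constant_on_def)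
  then obtain w where w: "norm (f w) > B"
    unfolding bounded_iff by (auto simp: not_le)
  show "\<forall>\<^sub>F r in at_top. B \<le> max_mod f r"
    using eventually_ge_at_top[of "norm w"]
  proof eventually_elim
    case (elim r)
    then show ?case
      using norm_le_max_mod[OF f elim] w by simp
  qed
qed

lemma filterlim_ln_max_mod_at_top:
  assumes "f holomorphic_on UNIV" "\<not> (\<exists>c. \<forall>w. f w = c)"
  shows "filterlim (\<lambda>r. ln (max_mod f r)) at_top at_top"
  by (rule filterlim_compose[OF ln_at_top filterlim_max_mod_at_top[OF assms]])

lemma entire_order_nonneg:
  assumes "f holomorphic_on UNIV" "\<not> (\<exists>c. \<forall>w. f w = c)"
  shows "entire_order f \<ge> 0"
  unfolding entire_order_def
proof (rule le_Limsup)
  have "\<forall>\<^sub>F r in at_top. ln (max_mod f r) \<ge> 1"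
    using filterlim_ln_max_mod_at_top[OF assms] by (simp add: filterlim_at_top)
  then show "\<forall>\<^sub>F r in at_top. 0 \<le> ereal (ln (ln (max_mod f r)) / ln r)"
    using eventually_ge_at_top[of 1] by eventually_elim simp
qed simp

lemma ln_max_mod_less_powr:
  assumes f: "f holomorphic_on UNIV" "\<not> (\<exists>c. \<forall>w. f w = c)" and t: "entire_order f < ereal t"
  shows "\<forall>\<^sub>F r in at_top. ln (max_mod f r) < r powr t"
proof -
  have "\<forall>\<^sub>F r in at_top. ereal (ln (ln (max_mod f r)) / ln r) < ereal t"
    using t unfolding entire_order_def by (rule Limsup_lessD)
  moreover have "\<forall>\<^sub>F r in at_top. ln (max_mod f r) \<ge> 1"
    using filterlim_ln_max_mod_at_top[OF f] by (simp add: filterlim_at_top)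
  ultimately show ?thesis
    using eventually_gt_at_top[of 1]
  proof eventually_elim
    case (elim r)
    then have "ln (ln (max_mod f r)) < t * ln r"
      by (simp add: field_simps)
    then have "exp (ln (ln (max_mod f r))) < exp (t * ln r)"
      by (simp only: exp_less_cancel_iff)
    then show ?case
      using elim by (simp add: powr_def)
  qed
qed

text \<open>The logarithmic terms are of smaller order than \<open>r powr s\<close>, so eventually
  \<open>ln (max_mod f r) \<le> C * r powr s\<close>. After a second logarithm the constant
  contributes only \<open>ln C / ln r\<close>, which tends to 0.\<close>

lemma entire_order_le:
  assumes f: "f holomorphic_on UNIV" "\<not> (\<exists>c. \<forall>w. f w = c)" and s: "s > 0"
    and le: "\<forall>\<^sub>F r in at_top. ln (max_mod f r) \<le> K + k * ln r + S * r powr s"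
  shows "entire_order f \<le> ereal s"
proof -
  \<comment> \<open>The absolute value keeps \<open>C\<close> positive for every \<open>S\<close>;
    the summand 1 pays for the logarithmic terms.\<close>
  define C where "C = \<bar>S\<bar> + 1"
  have C: "C > 0" "S + 1 \<le> C"
    by (auto simp: C_def)
  have "((\<lambda>r. (K + k * ln r) / r powr s) \<longlongrightarrow> 0) at_top"
    using s by real_asymp
  then have "\<forall>\<^sub>F r in at_top. (K + k * ln r) / r powr s < 1"
    by (rule order_tendstoD) simp
  moreover have "\<forall>\<^sub>F r in at_top. ln (max_mod f r) \<ge> 1"
    using filterlim_ln_max_mod_at_top[OF f] by (simp add: filterlim_at_top)
  ultimately have "\<forall>\<^sub>F r in at_top. ereal (ln (ln (max_mod f r)) / ln r) \<le> ereal (ln C / ln r + s)"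
    using le eventually_gt_at_top[of 1]
  proof eventually_elim
    case (elim r)
    have "ln (max_mod f r) \<le> r powr s + S * r powr s"
      using elim by (simp add: field_simps)
    also have "\<dots> = (S + 1) * r powr s"
      by (simp add: algebra_simps)
    also have "\<dots> \<le> C * r powr s"
      using C by (intro mult_right_mono) auto
    finally have "ln (ln (max_mod f r)) \<le> ln (C * r powr s)"
      using elim by (intro ln_mono) auto
    also have "\<dots> = ln C + s * ln r"
      using elim C by (simp add: ln_mult ln_powr)
    finally show ?case
      using elim by (simp add: field_simps)
  qed
  then have "entire_order f \<le> Limsup at_top (\<lambda>r. ereal (ln C / ln r + s))"
    unfolding entire_order_def by (rule Limsup_mono)
  also have "\<dots> = ereal s"
  proof (rule lim_imp_Limsup)
    have "((\<lambda>r. ln C / ln r + s) \<longlongrightarrow> s) at_top"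
      by real_asymp
    then show "((\<lambda>r. ereal (ln C / ln r + s)) \<longlongrightarrow> ereal s) at_top"
      by simp
  qed simp
  finally show ?thesis .
qed

section \<open>The orbit as a zero set, and growth estimates in both directions\<close>

lemma finite_orbit_ball:
  assumes f: "f holomorphic_on UNIV" "\<not> (\<exists>c. \<forall>w. f w = c)"
  shows "finite (orbit_set f z \<inter> ball 0 r)"
proof -
  obtain w0 where "f w0 - f z \<noteq> 0"
    using f(2) by auto
  moreover have "(\<lambda>w. f w - f z) holomorphic_on UNIV"
    by (intro holomorphic_intros f)
  ultimately have "finite ({w. f w - f z = 0} \<inter> ball 0 r)"
    by (intro entire_finite_zeros[of "\<lambda>w. f w - f z"])
  then show ?thesis
    by (simp add: orbit_set_def)
qed

text \<open>A zero at the origin is split off because factors \<open>1 - w / a\<close> need nonzero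
  \<open>a\<close>. Since \<open>w ^ k\<close> does not vanish at the zeros of \<open>G\<close>,
  their multiplicities agree with those in the orbit.\<close>

lemma orbit_factorization:
  assumes f: "f holomorphic_on UNIV" "\<not> (\<exists>c. \<forall>w. f w = c)"
  obtains G k where "G holomorphic_on UNIV" "G 0 \<noteq> 0" "\<And>w. f w - f z = G w * w ^ k"
    "\<And>r. {w. G w = 0} \<inter> ball 0 r = orbit_set f z \<inter> ball 0 r - {0}"
    "\<And>a. G a = 0 \<Longrightarrow> orbit_mult f z a = nat (zorder G a)"
    "orbit_mult f z 0 \<le> k"
proof -
  define F where "F = (\<lambda>w. f w - f z)"
  define k where "k = nat (zorder F 0)"
  have F: "F holomorphic_on UNIV"
    unfolding F_def by (intro holomorphic_intros f)
  obtain w0 where w0: "F w0 \<noteq> 0"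
    using f(2) by (auto simp: F_def)
  obtain G where G: "G holomorphic_on UNIV" "G 0 \<noteq> 0" "\<And>w. F w = G w * w ^ k"
    using entire_divide_zero[OF F w0, of 0] by (auto simp: k_def)
  show ?thesis
  proof (rule that[of G k])
    show "f w - f z = G w * w ^ k" for w
      using G(3)[of w] by (simp add: F_def)
    have "G w = 0 \<longleftrightarrow> f w = f z \<and> w \<noteq> 0" for w
      using G(2) G(3)[of w] by (cases "w = 0") (auto simp: F_def)
    then show "{w. G w = 0} \<inter> ball 0 r = orbit_set f z \<inter> ball 0 r - {0}" for r
      by (auto simp: orbit_set_def)
    show "orbit_mult f z 0 \<le> k"
      by (simp add: orbit_mult_def k_def F_def)
    fix a assume a: "G a = 0"
    obtain H where H: "H holomorphic_on UNIV" "H a \<noteq> 0" "\<And>w. G w = H w * (w - a) ^ nat (zorder G a)"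
      using entire_divide_zero[OF G(1,2)] by metis
    have "zorder F a = int (nat (zorder G a))"
    proof (rule zorder_entire_eqI)
      show "(\<lambda>w. H w * w ^ k) holomorphic_on UNIV"
        by (intro holomorphic_intros H)
      show "H a * a ^ k \<noteq> 0"
        using H(2) a G(2) by auto
      show "F w = H w * w ^ k * (w - a) ^ nat (zorder G a)" for w
        unfolding G(3)[of w] by (subst H(3)) simp
    qed
    moreover have "f a = f z"
      using a G(3)[of a] by (simp add: F_def)
    ultimately show "orbit_mult f z a = nat (zorder G a)"
      by (simp add: orbit_mult_def F_def)
  qed (use G in auto)
qed

lemma sphere_bound_of_factor:
  assumes f: "f holomorphic_on UNIV" and r: "1 \<le> r" "norm z \<le> r"
    and G: "\<And>w. f w - f z = G w * w ^ k" and w: "norm w = r"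
  shows "norm (G w) \<le> 2 * max_mod f r"
proof -
  have "norm (G w) * 1 \<le> norm (G w) * norm w ^ k"
    using r w by (intro mult_left_mono one_le_power) auto
  also have "\<dots> = norm (f w - f z)"
    by (simp add: G norm_mult norm_power)
  also have "\<dots> \<le> norm (f w) + norm (f z)"
    by (rule norm_triangle_ineq4)
  also have "\<dots> \<le> max_mod f r + max_mod f r"
    using w r by (intro add_mono norm_le_max_mod f) auto
  finally show ?thesis by simp
qed

lemma orbit_count_le_ln_max_mod:
  assumes f: "f holomorphic_on UNIV" "\<not> (\<exists>c. \<forall>w. f w = c)"
  shows "\<forall>\<^sub>F r in at_top. real (orbit_count f z r) \<le> 2 * ln (max_mod f (4 * r))"
proof -
  obtain G k where G: "G holomorphic_on UNIV" "G 0 \<noteq> 0" "\<And>w. f w - f z = G w * w ^ k"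
    "\<And>r. {w. G w = 0} \<inter> ball 0 r = orbit_set f z \<inter> ball 0 r - {0}"
    "\<And>a. G a = 0 \<Longrightarrow> orbit_mult f z a = nat (zorder G a)"
    "orbit_mult f z 0 \<le> k"
    using orbit_factorization[OF f] by metis
  \<comment> \<open>\<open>K\<close> collects the constants from
    \<open>norm (G 0) * 3 ^ n \<le> 2 * M\<close> and from the zero at the origin. Once
    \<open>ln M\<close> exceeds \<open>K\<close>, a second copy of \<open>ln M\<close> absorbs them,
    whence the factor 2.\<close>
  define K where "K = max 1 (ln 2 - ln (norm (G 0)) + real k)"
  have "filterlim (\<lambda>r::real. 4 * r) at_top at_top"
    by real_asymp
  then have "filterlim (\<lambda>r. ln (max_mod f (4 * r))) at_top at_top"
    by (rule filterlim_compose[OF filterlim_ln_max_mod_at_top[OF f]])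
  then have "\<forall>\<^sub>F r in at_top. K \<le> ln (max_mod f (4 * r))"
    by (simp add: filterlim_at_top)
  then show ?thesis
    using eventually_ge_at_top[of 1] eventually_ge_at_top[of "norm z"]
  proof eventually_elim
    case (elim r)
    define n where "n = (\<Sum>a\<in>{w. G w = 0} \<inter> ball 0 r. nat (zorder G a))"
    define M where "M = max_mod f (4 * r)"
    have "M \<ge> norm (f z)"
      unfolding M_def using elim by (intro norm_le_max_mod f) auto
    then have "M \<ge> 0"
      using norm_ge_zero order_trans by blast
    moreover have "ln M \<ge> 1"
      using elim by (simp add: M_def K_def)
    \<comment> \<open>The default value \<open>ln 0 = 0\<close> makes \<open>ln M \<ge> 1\<close>
      exclude \<open>M = 0\<close>.\<close>
    ultimately have M: "M > 0"
      by (cases "M = 0") auto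
    \<comment> \<open>Inserting 0 treats both cases at once: off the orbit its multiplicity is
      0.\<close>
    have "orbit_count f z r \<le> (\<Sum>a\<in>insert 0 (orbit_set f z \<inter> ball 0 r - {0}). orbit_mult f z a)"
      unfolding orbit_count_def using finite_orbit_ball[OF f] by (intro sum_mono2) auto
    also have "\<dots> = orbit_mult f z 0 + (\<Sum>a\<in>orbit_set f z \<inter> ball 0 r - {0}. orbit_mult f z a)"
      using finite_orbit_ball[OF f] by (subst sum.insert) auto
    also have "(\<Sum>a\<in>orbit_set f z \<inter> ball 0 r - {0}. orbit_mult f z a) = n"
      unfolding n_def G(4)[symmetric] by (intro sum.cong refl G(5)) auto
    finally have count: "orbit_count f z r \<le> k + n"
      using G(6) by simp
    have "norm (G 0) * 3 ^ n \<le> 2 * M"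
      unfolding n_def M_def
      by (rule zero_count_le[OF G(1,2)]) (use elim in \<open>auto intro!: sphere_bound_of_factor[OF f(1) _ _ G(3)]\<close>)
    then have "ln (norm (G 0) * 3 ^ n) \<le> ln (2 * M)"
      using G(2) by (intro ln_mono) auto
    then have "real n * ln 3 \<le> ln 2 + ln M - ln (norm (G 0))"
      using G(2) M by (simp add: ln_mult ln_realpow)
    moreover have "ln (3::real) \<ge> 1"
      using exp_le by (subst ln_ge_iff) auto
    then have "real n * 1 \<le> real n * ln 3"
      by (intro mult_left_mono) auto
    ultimately have "real n \<le> ln 2 + ln M - ln (norm (G 0))"
      by simp
    then show ?case
      using count elim unfolding M_def[symmetric] K_def by linarith
  qed
qed

text \<open>The number \<open>B\<close> is quantified under the eventuality, so it may be chosen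
  depending on \<open>r\<close>; it bounds the finite sums for all \<open>R\<close> instead of an
  infinite sum. The constants come from \<open>norm (f z)\<close>, \<open>norm (G 0)\<close> and the
  factor \<open>w ^ k\<close>.\<close>

lemma ln_max_mod_le_orbit_sum:
  assumes f: "f holomorphic_on UNIV" "\<not> (\<exists>c. \<forall>w. f w = c)"
    and sublinear: "((\<lambda>r. ln (max_mod f r) / r) \<longlongrightarrow> 0) at_top"
  obtains K k where "\<forall>\<^sub>F r in at_top. \<forall>B\<ge>0.
    (\<forall>R. (\<Sum>a\<in>orbit_set f z \<inter> ball 0 R - {0}. real (orbit_mult f z a) * ln (1 + r / norm a)) \<le> B)
    \<longrightarrow> ln (max_mod f r) \<le> K + k * ln r + B"
proof -
  obtain G k where G: "G holomorphic_on UNIV" "G 0 \<noteq> 0" "\<And>w. f w - f z = G w * w ^ k"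
    "\<And>r. {w. G w = 0} \<inter> ball 0 r = orbit_set f z \<inter> ball 0 r - {0}"
    "\<And>a. G a = 0 \<Longrightarrow> orbit_mult f z a = nat (zorder G a)"
    using orbit_factorization[OF f] by metis
  \<comment> \<open>Since \<open>r ^ k * exp B \<ge> 1\<close> for \<open>r \<ge> 1\<close> and
    \<open>B \<ge> 0\<close>, the summand \<open>norm (f z)\<close> can be multiplied by it and
    merged with the bound for \<open>G\<close>.\<close>
  define c where "c = norm (f z) + norm (G 0)"
  have c: "c > 0"
    using G(2) by (simp add: c_def add_nonneg_pos)
  have pos: "\<forall>\<^sub>F r in at_top. max_mod f r \<ge> 1"
    using filterlim_max_mod_at_top[OF f] by (simp add: filterlim_at_top)
  have bound: "\<forall>\<^sub>F R in at_top. \<forall>w. norm w = R \<longrightarrow> norm (G w) \<le> 2 * max_mod f R"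
    using eventually_ge_at_top[of 1] eventually_ge_at_top[of "norm z"]
    by eventually_elim (auto intro!: sphere_bound_of_factor[OF f(1) _ _ G(3)])
  have "((\<lambda>R. ln 2 / R + ln (max_mod f R) / R) \<longlongrightarrow> 0 + 0) at_top"
    by (intro tendsto_add sublinear) real_asymp
  moreover have "\<forall>\<^sub>F R in at_top. ln 2 / R + ln (max_mod f R) / R = ln (2 * max_mod f R) / R"
    using pos by eventually_elim (simp add: ln_mult add_divide_distrib)
  ultimately have sub2: "((\<lambda>R. ln (2 * max_mod f R) / R) \<longlongrightarrow> 0) at_top"
    by (auto intro: Lim_transform_eventually)
  have "\<forall>\<^sub>F r in at_top. \<forall>B\<ge>0.
    (\<forall>R. (\<Sum>a\<in>orbit_set f z \<inter> ball 0 R - {0}. real (orbit_mult f z a) * ln (1 + r / norm a)) \<le> B)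
    \<longrightarrow> ln (max_mod f r) \<le> ln c + real k * ln r + B"
    using pos eventually_ge_at_top[of 1]
  proof eventually_elim
    case (elim r)
    have "ln (max_mod f r) \<le> ln c + real k * ln r + B" if B: "B \<ge> 0"
      "\<And>R. (\<Sum>a\<in>orbit_set f z \<inter> ball 0 R - {0}. real (orbit_mult f z a) * ln (1 + r / norm a)) \<le> B" for B
    proof -
      have "norm (f w) \<le> c * r ^ k * exp B" if w: "norm w = r" for w
      proof -
        have "norm (G w) \<le> norm (G 0) * exp B"
        proof (rule norm_le_exp_zero_sum[OF G(1,2) bound sub2])
          fix R
          have "(\<Sum>a\<in>{w. G w = 0} \<inter> ball 0 R. real (nat (zorder G a)) * ln (1 + norm w / norm a))
            = (\<Sum>a\<in>{w. G w = 0} \<inter> ball 0 R. real (orbit_mult f z a) * ln (1 + r / norm a))"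
            using w by (intro sum.cong refl) (simp add: G(5))
          then show "(\<Sum>a\<in>{w. G w = 0} \<inter> ball 0 R. real (nat (zorder G a)) * ln (1 + norm w / norm a)) \<le> B"
            using B(2)[of R] by (simp add: G(4))
        qed
        then have "norm (f w - f z) \<le> norm (G 0) * exp B * r ^ k"
          unfolding G(3) norm_mult norm_power w using elim by (intro mult_right_mono) auto
        moreover have "1 * 1 \<le> r ^ k * exp B"
          using elim B(1) by (intro mult_mono) auto
        then have "norm (f z) * 1 \<le> norm (f z) * (r ^ k * exp B)"
          by (intro mult_left_mono) auto
        moreover have "norm (f w) \<le> norm (f z) + norm (f w - f z)"
          by (rule norm_triangle_sub)
        ultimately show ?thesis
          by (simp add: c_def algebra_simps)
      qed
      then have "max_mod f r \<le> c * r ^ k * exp B"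
        using elim by (intro max_mod_le) auto
      then have "ln (max_mod f r) \<le> ln (c * r ^ k * exp B)"
        using elim by (intro ln_mono) auto
      then show ?thesis
        using elim c by (simp add: ln_mult ln_realpow)
    qed
    then show ?case by blast
  qed
  then show ?thesis
    by (rule that)
qed

section \<open>Order and type against the orbit\<close>

lemma orbit_sum_le_orbit_count:
  assumes f: "f holomorphic_on UNIV" "\<not> (\<exists>c. \<forall>w. f w = c)" and A: "A \<subseteq> orbit_set f z"
  shows "(\<Sum>a\<in>{a\<in>A. norm a < x}. real (orbit_mult f z a)) \<le> real (orbit_count f z x)"
  unfolding orbit_count_def of_nat_sum
  using finite_orbit_ball[OF f] A by (intro sum_mono2) auto

section \<open>Order against convergence exponent\<close>

lemma sublinear_ln_max_mod:
  assumes f: "f holomorphic_on UNIV" "\<not> (\<exists>c. \<forall>w. f w = c)" and order: "entire_order f < 1"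
  shows "((\<lambda>r. ln (max_mod f r) / r) \<longlongrightarrow> 0) at_top"
proof -
  obtain t where t: "entire_order f < ereal t" "t < 1"
    using ereal_dense2[OF order] by (auto simp: one_ereal_def)
  show ?thesis
  proof (rule tendsto_sandwich)
    have "\<forall>\<^sub>F r in at_top. ln (max_mod f r) \<ge> 0"
      using filterlim_ln_max_mod_at_top[OF f] by (simp add: filterlim_at_top)
    then show "\<forall>\<^sub>F r in at_top. 0 \<le> ln (max_mod f r) / r"
      using eventually_gt_at_top[of 0] by eventually_elim simp
    show "\<forall>\<^sub>F r in at_top. ln (max_mod f r) / r \<le> r powr t / r"
      using ln_max_mod_less_powr[OF f t(1)] eventually_gt_at_top[of 0]
      by eventually_elim (simp add: divide_right_mono)
    show "((\<lambda>r. r powr t / r) \<longlongrightarrow> 0) at_top"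
      using t(2) by real_asymp
  qed simp
qed

text \<open>For \<open>t\<close> strictly between the order and \<open>s\<close>, the orbit count is
  \<open>O(r powr t)\<close>. The outer dyadic estimate then bounds all finite partial sums
  uniformly, which suffices for nonnegative terms.\<close>

lemma orbit_summable:
  assumes f: "f holomorphic_on UNIV" "\<not> (\<exists>c. \<forall>w. f w = c)" and s: "entire_order f < ereal s"
  shows "(\<lambda>w. real (orbit_mult f z w) * norm w powr (-s)) summable_on (orbit_set f z - {0})"
proof -
  obtain t where t: "entire_order f < ereal t" "t < s"
    using ereal_dense2[OF s] by auto
  have "s > 0"
    using le_less_trans[OF entire_order_nonneg[OF f] s] by simp
  define m where "m = (\<lambda>a. real (orbit_mult f z a))"
  \<comment> \<open>The constant arises from twice \<open>ln (max_mod f (4 * r))\<close>, which is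
    eventually below \<open>2 * (4 * r) powr t\<close>.\<close>
  define D where "D = 2 * 4 powr t"
  have "filterlim (\<lambda>r::real. 4 * r) at_top at_top"
    by real_asymp
  then have "\<forall>\<^sub>F r in at_top. ln (max_mod f (4 * r)) < (4 * r) powr t"
    by (rule eventually_compose_filterlim[OF ln_max_mod_less_powr[OF f t(1)]])
  then have "\<forall>\<^sub>F r in at_top. real (orbit_count f z r) \<le> D * r powr t"
    using orbit_count_le_ln_max_mod[OF f, of z] eventually_gt_at_top[of 0]
    by eventually_elim (simp add: D_def powr_mult)
  then obtain r1 where r1: "\<And>r. r \<ge> r1 \<Longrightarrow> real (orbit_count f z r) \<le> D * r powr t"
    unfolding eventually_at_top_linorder by blast
  define r where "r = max 1 r1"
  have r: "r > 0" "r \<ge> r1"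
    by (auto simp: r_def)
  define S where "S = (\<Sum>a\<in>orbit_set f z \<inter> ball 0 r. m a * norm a powr (-s))
      + r powr (-s) * (2 powr t / (1 - 2 powr (t - s)) * D * r powr t)"
  show ?thesis
  proof (rule nonneg_bdd_above_summable_on)
    have "(\<Sum>a\<in>A. m a * norm a powr (-s)) \<le> S" if A: "A \<subseteq> orbit_set f z - {0}" "finite A" for A
    proof -
      have "A = {a\<in>A. norm a < r} \<union> {a\<in>A. r \<le> norm a}"
        by auto
      then have "(\<Sum>a\<in>A. m a * norm a powr (-s))
        = (\<Sum>a\<in>{a\<in>A. norm a < r} \<union> {a\<in>A. r \<le> norm a}. m a * norm a powr (-s))"
        by simp
      also have "\<dots> = (\<Sum>a\<in>{a\<in>A. norm a < r}. m a * norm a powr (-s))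
          + (\<Sum>a\<in>{a\<in>A. r \<le> norm a}. m a * norm a powr (-s))"
        using A by (intro sum.union_disjoint) auto
      also have "(\<Sum>a\<in>{a\<in>A. norm a < r}. m a * norm a powr (-s))
          \<le> (\<Sum>a\<in>orbit_set f z \<inter> ball 0 r. m a * norm a powr (-s))"
        using A finite_orbit_ball[OF f] by (intro sum_mono2) (auto simp: m_def)
      also have "(\<Sum>a\<in>{a\<in>A. r \<le> norm a}. m a * norm a powr (-s))
          = r powr (-s) * (\<Sum>a\<in>{a\<in>A. r \<le> norm a}. m a * (r / norm a) powr s)"
        unfolding sum_distrib_left using r
        by (intro sum.cong refl) (auto simp: powr_divide powr_minus field_simps)
      also have "\<dots> \<le> r powr (-s) * (2 powr t / (1 - 2 powr (t - s)) * D * r powr t)"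
      proof (intro mult_left_mono sum_outer_layers_le)
        fix x assume "x \<ge> r"
        then show "(\<Sum>a\<in>{a\<in>A. norm a < x}. m a) \<le> D * x powr t"
          using order_trans[OF orbit_sum_le_orbit_count[OF f] r1[of x]] A r by (auto simp: m_def)
      qed (use A r t \<open>s > 0\<close> in \<open>auto simp: m_def D_def\<close>)
      finally show ?thesis
        by (simp add: S_def)
    qed
    then show "bdd_above (sum (\<lambda>w. real (orbit_mult f z w) * norm w powr (-s))
        ` {F. F \<subseteq> orbit_set f z - {0} \<and> finite F})"
      unfolding m_def by (intro bdd_aboveI[of _ S]) auto
  qed auto
qed

text \<open>Bounding each logarithm by a power of exponent \<open>s\<close> turns the orbit sum into
  \<open>r powr s / s\<close> times the convergent series. Order less than 1 enters through
  sublinear growth.\<close>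

lemma order_le_of_orbit_summable:
  assumes f: "f holomorphic_on UNIV" "\<not> (\<exists>c. \<forall>w. f w = c)" and order: "entire_order f < 1"
    and s: "0 < s" "s \<le> 1"
    and sum: "(\<lambda>w. real (orbit_mult f z w) * norm w powr (-s)) summable_on (orbit_set f z - {0})"
  shows "entire_order f \<le> ereal s"
proof -
  define S where "S = infsum (\<lambda>w. real (orbit_mult f z w) * norm w powr (-s)) (orbit_set f z - {0})"
  have "S \<ge> 0"
    unfolding S_def by (intro infsum_nonneg) auto
  obtain K k where K: "\<forall>\<^sub>F r in at_top. \<forall>B\<ge>0.
    (\<forall>R. (\<Sum>a\<in>orbit_set f z \<inter> ball 0 R - {0}. real (orbit_mult f z a) * ln (1 + r / norm a)) \<le> B)
    \<longrightarrow> ln (max_mod f r) \<le> K + k * ln r + B"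
    by (rule ln_max_mod_le_orbit_sum[OF f sublinear_ln_max_mod[OF f order]])
  have "\<forall>\<^sub>F r in at_top. ln (max_mod f r) \<le> K + k * ln r + S / s * r powr s"
    using K eventually_gt_at_top[of 0]
  proof eventually_elim
    case (elim r)
    have "(\<Sum>a\<in>orbit_set f z \<inter> ball 0 R - {0}. real (orbit_mult f z a) * ln (1 + r / norm a))
      \<le> S / s * r powr s" for R
    proof -
      have "(\<Sum>a\<in>orbit_set f z \<inter> ball 0 R - {0}. real (orbit_mult f z a) * ln (1 + r / norm a))
        \<le> (\<Sum>a\<in>orbit_set f z \<inter> ball 0 R - {0}. real (orbit_mult f z a) * ((r / norm a) powr s / s))"
        using elim s by (intro sum_mono mult_left_mono ln_one_plus_le_powr) auto
      also have "\<dots> = r powr s / s *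
          (\<Sum>a\<in>orbit_set f z \<inter> ball 0 R - {0}. real (orbit_mult f z a) * norm a powr (-s))"
        unfolding sum_distrib_left using elim
        by (intro sum.cong refl) (auto simp: powr_divide powr_minus field_simps)
      also have "\<dots> \<le> r powr s / s * S"
        unfolding S_def using s finite_orbit_ball[OF f] sum
        by (intro mult_left_mono finite_sum_le_infsum) auto
      finally show ?thesis by (simp add: mult.commute)
    qed
    moreover have "S / s * r powr s \<ge> 0"
      using \<open>S \<ge> 0\<close> s by simp
    ultimately show ?case
      using elim by blast
  qed
  then show ?thesis
    using entire_order_le[OF f s(1)] by blast
qed

lemma orbit_conv_exp_eq_order:
  assumes f: "f holomorphic_on UNIV" "\<not> (\<exists>c. \<forall>w. f w = c)" and order: "entire_order f < 1"
  shows "orbit_conv_exp f z = entire_order f"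
proof (rule antisym)
  show "orbit_conv_exp f z \<le> entire_order f"
  proof (rule dense_ge)
    fix y assume "y > entire_order f"
    from ereal_dense2[OF this] obtain s where s: "entire_order f < ereal s" "ereal s < y"
      by blast
    have "s > 0"
      using le_less_trans[OF entire_order_nonneg[OF f] s(1)] by simp
    then have "orbit_conv_exp f z \<le> ereal s"
      unfolding orbit_conv_exp_def using orbit_summable[OF f s(1)] by (intro Inf_lower) auto
    with s show "orbit_conv_exp f z \<le> y" by simp
  qed
  show "entire_order f \<le> orbit_conv_exp f z"
    unfolding orbit_conv_exp_def
  proof (rule Inf_greatest, clarify)
    fix s :: real
    assume s: "0 < s" and
      "(\<lambda>w. real (orbit_mult f z w) * norm w powr (-s)) summable_on (orbit_set f z - {0})"
    then show "entire_order f \<le> ereal s"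
    proof (cases "s \<le> 1")
      case True
      with s show ?thesis
        using order_le_of_orbit_summable[OF f order] \<open>_ summable_on _\<close> by blast
    next
      \<comment> \<open>The logarithmic bound covers exponents up to 1; beyond that the assumption
        on the order gives the inequality directly.\<close>
      case False
      then have "1 < ereal s"
        by (simp add: one_ereal_def)
      with order show ?thesis
        by (meson less_imp_le less_trans)
    qed
  qed
qed

section \<open>Type against upper density\<close>

lemma density_le_type:
  assumes f: "f holomorphic_on UNIV" "\<not> (\<exists>c. \<forall>w. f w = c)"
    and c: "entire_type f t < ereal c"
  shows "orbit_upper_density f z t \<le> ereal (2 * 4 powr t * c)"
  unfolding orbit_upper_density_def
proof (rule Limsup_bounded)
  have "\<forall>\<^sub>F r in at_top. ereal (ln (max_mod f r) / r powr t) < ereal c"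
    using c unfolding entire_type_def by (rule Limsup_lessD)
  moreover have "filterlim (\<lambda>r::real. 4 * r) at_top at_top"
    by real_asymp
  \<comment> \<open>Evaluating at \<open>4 * r\<close> matches the radius in the counting bound and
    costs the factor \<open>4 powr t\<close>.\<close>
  ultimately have "\<forall>\<^sub>F r in at_top. ereal (ln (max_mod f (4 * r)) / (4 * r) powr t) < ereal c"
    by (rule eventually_compose_filterlim)
  then show "\<forall>\<^sub>F r in at_top. ereal (real (orbit_count f z r) / r powr t) \<le> ereal (2 * 4 powr t * c)"
    using orbit_count_le_ln_max_mod[OF f, of z] eventually_gt_at_top[of 0]
  proof eventually_elim
    case (elim r)
    then have "ln (max_mod f (4 * r)) \<le> c * (4 powr t * r powr t)"
      by (simp add: powr_mult field_simps)
    then have "2 * ln (max_mod f (4 * r)) \<le> 2 * 4 powr t * c * r powr t"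
      by (simp add: mult_ac)
    with elim(2) have "real (orbit_count f z r) \<le> 2 * 4 powr t * c * r powr t"
      by (rule order_trans)
    then show ?case
      using elim by (simp add: field_simps)
  qed
qed

lemma orbit_upper_density_nonneg: "orbit_upper_density f z t \<ge> 0"
  unfolding orbit_upper_density_def by (rule le_Limsup) auto

lemma entire_type_nonneg:
  assumes "f holomorphic_on UNIV" "\<not> (\<exists>c. \<forall>w. f w = c)"
  shows "entire_type f t \<ge> 0"
  unfolding entire_type_def
proof (rule le_Limsup)
  have "\<forall>\<^sub>F r in at_top. ln (max_mod f r) \<ge> 0"
    using filterlim_ln_max_mod_at_top[OF assms] by (simp add: filterlim_at_top)
  then show "\<forall>\<^sub>F r in at_top. 0 \<le> ereal (ln (max_mod f r) / r powr t)"
    by eventually_elim simp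
qed simp

text \<open>Beyond some radius \<open>r0\<close> the count is at most \<open>c * r powr t\<close>,
  and the dyadic estimate applies. The finitely many nonzero orbit points inside \<open>r0\<close>
  contribute \<open>E r\<close>, which is negligible against \<open>r powr t\<close>, as are the
  logarithmic terms. The limit retains only a fixed multiple of \<open>c\<close>.\<close>

lemma type_le_density:
  assumes f: "f holomorphic_on UNIV" "\<not> (\<exists>c. \<forall>w. f w = c)" and order: "entire_order f < 1"
    and t: "0 < t" "t < 1" and c: "orbit_upper_density f z t < ereal c"
  shows "entire_type f t \<le> ereal (layer_const t * c)"
proof -
  obtain K k where K: "\<forall>\<^sub>F r in at_top. \<forall>B\<ge>0.
    (\<forall>R. (\<Sum>a\<in>orbit_set f z \<inter> ball 0 R - {0}. real (orbit_mult f z a) * ln (1 + r / norm a)) \<le> B)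
    \<longrightarrow> ln (max_mod f r) \<le> K + k * ln r + B"
    by (rule ln_max_mod_le_orbit_sum[OF f sublinear_ln_max_mod[OF f order]])
  define m where "m = (\<lambda>a. real (orbit_mult f z a))"
  have "c > 0"
    using le_less_trans[OF orbit_upper_density_nonneg c] by simp
  have "\<forall>\<^sub>F r in at_top. ereal (real (orbit_count f z r) / r powr t) < ereal c"
    using c unfolding orbit_upper_density_def by (rule Limsup_lessD)
  then have "\<forall>\<^sub>F r in at_top. real (orbit_count f z r) \<le> c * r powr t"
    using eventually_gt_at_top[of 0] by eventually_elim (simp add: field_simps)
  then obtain r1 where r1: "\<And>r. r \<ge> r1 \<Longrightarrow> real (orbit_count f z r) \<le> c * r powr t"
    unfolding eventually_at_top_linorder by blast
  define r0 where "r0 = max 1 r1"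
  have r0: "r0 > 0" "r0 \<ge> r1"
    by (auto simp: r0_def)
  define E where "E = (\<lambda>r. \<Sum>a\<in>orbit_set f z \<inter> ball 0 r0 - {0}. m a * ln (1 + r / norm a))"
  have lim: "((\<lambda>r. ln (1 + r / norm a) / r powr t) \<longlongrightarrow> 0) at_top" if "a \<noteq> 0" for a :: complex
  proof -
    have "norm a > 0" using that by simp
    then show ?thesis using t by real_asymp
  qed
  have "((\<lambda>r. \<Sum>a\<in>orbit_set f z \<inter> ball 0 r0 - {0}. m a * (ln (1 + r / norm a) / r powr t))
      \<longlongrightarrow> (\<Sum>a\<in>orbit_set f z \<inter> ball 0 r0 - {0}. m a * 0)) at_top"
    by (intro tendsto_intros lim) auto
  then have E_lim: "((\<lambda>r. E r / r powr t) \<longlongrightarrow> 0) at_top"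
    by (simp add: E_def sum_divide_distrib)
  have "\<forall>\<^sub>F r in at_top. ereal (ln (max_mod f r) / r powr t)
      \<le> ereal ((K + k * ln r) / r powr t + E r / r powr t + layer_const t * c)"
    using K eventually_ge_at_top[of r0]
  proof eventually_elim
    case (elim r)
    have r: "r > 0" using elim r0 by simp
    have "E r \<ge> 0"
      unfolding E_def m_def using r by (intro sum_nonneg mult_nonneg_nonneg) auto
    have "(\<Sum>a\<in>orbit_set f z \<inter> ball 0 R - {0}. m a * ln (1 + r / norm a)) \<le> E r + layer_const t * c * r powr t" for R
    proof -
      define A where "A = orbit_set f z \<inter> ball 0 R - {0}"
      have A: "finite A" "A \<subseteq> orbit_set f z" "0 \<notin> A"
        using finite_orbit_ball[OF f] by (auto simp: A_def)
      have "A = {a\<in>A. norm a < r0} \<union> {a\<in>A. r0 \<le> norm a}"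
        by auto
      then have "(\<Sum>a\<in>A. m a * ln (1 + r / norm a))
        = (\<Sum>a\<in>{a\<in>A. norm a < r0} \<union> {a\<in>A. r0 \<le> norm a}. m a * ln (1 + r / norm a))"
        by simp
      also have "\<dots> = (\<Sum>a\<in>{a\<in>A. norm a < r0}. m a * ln (1 + r / norm a))
          + (\<Sum>a\<in>{a\<in>A. r0 \<le> norm a}. m a * ln (1 + r / norm a))"
        using A by (intro sum.union_disjoint) auto
      also have "(\<Sum>a\<in>{a\<in>A. norm a < r0}. m a * ln (1 + r / norm a)) \<le> E r"
        unfolding E_def using A r finite_orbit_ball[OF f]
        by (intro sum_mono2) (auto simp: m_def)
      also have "(\<Sum>a\<in>{a\<in>A. r0 \<le> norm a}. m a * ln (1 + r / norm a)) \<le> layer_const t * c * r powr t"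
      proof (rule ln_sum_le_layer_const[OF t])
        fix x assume "x \<ge> r0"
        then show "(\<Sum>a\<in>{a\<in>A. norm a < x}. m a) \<le> c * x powr t"
          using orbit_sum_le_orbit_count[OF f A(2), of x] r1[of x] r0 by (auto simp: m_def)
      qed (use A r0 elim \<open>c > 0\<close> in \<open>auto simp: m_def\<close>)
      finally show ?thesis by (simp add: A_def)
    qed
    moreover have "E r + layer_const t * c * r powr t \<ge> 0"
      using \<open>E r \<ge> 0\<close> layer_const_pos[OF t] \<open>c > 0\<close> by simp
    ultimately have "ln (max_mod f r) \<le> K + k * ln r + (E r + layer_const t * c * r powr t)"
      using elim(1) unfolding m_def by blast
    then have "ln (max_mod f r) / r powr t \<le> (K + k * ln r + (E r + layer_const t * c * r powr t)) / r powr t"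
      by (intro divide_right_mono) auto
    also have "\<dots> = (K + k * ln r) / r powr t + E r / r powr t + layer_const t * c"
      using r by (simp add: add_divide_distrib)
    finally show ?case by simp
  qed
  then have "entire_type f t \<le> Limsup at_top (\<lambda>r. ereal ((K + k * ln r) / r powr t + E r / r powr t + layer_const t * c))"
    unfolding entire_type_def by (rule Limsup_mono)
  also have "\<dots> = ereal (layer_const t * c)"
  proof (rule lim_imp_Limsup)
    have "((\<lambda>r. (K + k * ln r) / r powr t) \<longlongrightarrow> 0) at_top"
      using t by real_asymp
    from tendsto_add[OF tendsto_add[OF this E_lim] tendsto_const[of "layer_const t * c"]]
    show "((\<lambda>r. ereal ((K + k * ln r) / r powr t + E r / r powr t + layer_const t * c)) \<longlongrightarrow> ereal (layer_const t * c)) at_top"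
      by simp
  qed simp
  finally show ?thesis .
qed

text \<open>Isolates what a linear comparison with a fixed constant yields: finiteness and vanishing
  pass from \<open>x\<close> to \<open>y\<close>. For vanishing, \<open>c\<close> is taken as
  \<open>e / C\<close> with \<open>e\<close> arbitrarily small.\<close>

lemma ereal_dominated:
  fixes x y :: ereal
  assumes "y \<ge> 0" "C > 0" and le: "\<And>c. x < ereal c \<Longrightarrow> y \<le> ereal (C * c)"
  shows "x < \<infinity> \<Longrightarrow> y < \<infinity>" "x = 0 \<Longrightarrow> y = 0"
proof -
  show "y < \<infinity>" if x: "x < \<infinity>"
  proof -
    obtain c where "x < ereal c"
      using ereal_dense2[OF x] by blast
    then have "y \<le> ereal (C * c)"
      by (rule le)
    also have "\<dots> < \<infinity>"
      by simp
    finally show ?thesis .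
  qed
  assume x: "x = 0"
  have "y \<le> 0"
  proof (rule ereal_le_epsilon2)
    fix e :: real assume "e > 0"
    then have "x < ereal (e / C)"
      using x \<open>C > 0\<close> by simp
    from le[OF this] show "y \<le> 0 + ereal e"
      using \<open>C > 0\<close> by simp
  qed
  with \<open>y \<ge> 0\<close> show "y = 0" by simp
qed

theorem theorem9:
  fixes f :: "complex \<Rightarrow> complex" and \<rho> :: real
  assumes entire: "f holomorphic_on UNIV"
    and nonconst: "\<not> (\<exists>c. \<forall>w. f w = c)"
    and order: "entire_order f = ereal \<rho>"
    and rho_lt: "\<rho> < 1"
  shows "(\<forall>z. orbit_conv_exp f z = ereal \<rho>)
       \<and> (\<rho> \<noteq> 0 \<longrightarrow>
           (\<forall>z. (entire_type f \<rho> = \<infinity> \<longleftrightarrow> orbit_upper_density f z \<rho> = \<infinity>)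
              \<and> (entire_type f \<rho> = 0 \<longleftrightarrow> orbit_upper_density f z \<rho> = 0)
              \<and> ((0 < entire_type f \<rho> \<and> entire_type f \<rho> < \<infinity>) \<longleftrightarrow>
                   (0 < orbit_upper_density f z \<rho> \<and> orbit_upper_density f z \<rho> < \<infinity>))))"
proof (intro conjI impI allI)
  note f = entire nonconst
  have lt1: "entire_order f < 1"
    using order rho_lt by (simp add: one_ereal_def)
  show "orbit_conv_exp f z = ereal \<rho>" for z
    using orbit_conv_exp_eq_order[OF f lt1] order by simp
  fix z assume "\<rho> \<noteq> 0"
  with entire_order_nonneg[OF f] order have "\<rho> > 0"
    by simp
  \<comment> \<open>Type and density dominate each other up to constants depending only on
    \<open>\<rho>\<close>, so finiteness and vanishing transfer in both directions.\<close>
  have type_dominated: "orbit_upper_density f z \<rho> < \<infinity> \<Longrightarrow> entire_type f \<rho> < \<infinity>"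
    "orbit_upper_density f z \<rho> = 0 \<Longrightarrow> entire_type f \<rho> = 0"
    by (rule ereal_dominated[OF entire_type_nonneg[OF f] layer_const_pos[OF \<open>\<rho> > 0\<close> rho_lt]
          type_le_density[OF f lt1 \<open>\<rho> > 0\<close> rho_lt]]; assumption)+
  have four: "2 * 4 powr \<rho> > 0"
    by simp
  have density_dominated: "entire_type f \<rho> < \<infinity> \<Longrightarrow> orbit_upper_density f z \<rho> < \<infinity>"
    "entire_type f \<rho> = 0 \<Longrightarrow> orbit_upper_density f z \<rho> = 0"
    by (rule ereal_dominated[OF orbit_upper_density_nonneg four density_le_type[OF f]]; assumption)+
  have fin: "entire_type f \<rho> < \<infinity> \<longleftrightarrow> orbit_upper_density f z \<rho> < \<infinity>"
    using type_dominated(1) density_dominated(1) by blast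
  then show "entire_type f \<rho> = \<infinity> \<longleftrightarrow> orbit_upper_density f z \<rho> = \<infinity>"
    by auto
  show zero: "entire_type f \<rho> = 0 \<longleftrightarrow> orbit_upper_density f z \<rho> = 0"
    using type_dominated(2) density_dominated(2) by blast
  \<comment> \<open>Both quantities are nonnegative, so positivity is the negation of vanishing and
    the third alternative follows from the other two.\<close>
  show "0 < entire_type f \<rho> \<and> entire_type f \<rho> < \<infinity> \<longleftrightarrow>
      0 < orbit_upper_density f z \<rho> \<and> orbit_upper_density f z \<rho> < \<infinity>"
    using fin zero entire_type_nonneg[OF f, of \<rho>] orbit_upper_density_nonneg[of f z \<rho>]
    by (metis less_le)
qed

end
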